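(* Let there be $n$ options. For each $j\in\{1,\dots,n\}$ let $y_j\in\{\text{single},\text{shared}\}$ be the service type of option $j$, let $f_j,c_j,T_j\in\mathbb{R}_+$ be given constants, and let $U_0$ be a given constant. Consider the problem $$\max_{\delta\in\mathbb{R}^n}\ \frac{\sum_{j=1}^n e^{U_j(\delta_j)}\,(f_j-c_j+\delta_j)}{\sum_{j=1}^n e^{U_j(\delta_j)}+e^{U_0}}$$ with utilities $U_j=U_j(\delta_j)=U_{j0}+E_{y_j}(\delta_j)$, where $U_{j0}=U'_{y_j}(f_j,T_j)$ is constant (does not depend on $\delta$) for all $j$, and, for every service type $y$, $$E_y(x)=-e_{y1}\min\{0,x\}-e_{y2}\max\{0,x\},\qquad e_{y2}>e_{y1}>0.$$ Then the optimal objective value $z^*$ of this problem can be solved by the following iterative algorithm: $$\delta_j^{k+1}=\begin{cases} z^k-f_j+c_j+1/e_{y_j1} & \text{if } z^k-f_j+c_j+1/e_{y_j1}<0,\\ z^k-f_j+c_j+1/e_{y_j2} & \text{if } z^k-f_j+c_j+1/e_{y_j2}>0,\\ 0 & \text{otherwise,}\end{cases}$$ $$z^{k+1}=\frac{\sum_{j=1}^n V_{j0}\,e^{E_{y_j}(\delta_j^{k+1})}\,(f_j-c_j+\delta_j^{k+1})}{\sum_{j=1}^n V_{j0}\,e^{E_{y_j}(\delta_j^{k+1})}+V_0},$$ where $V_{j0}=e^{U_{j0}}$ and $V_0=e^{U_0}$.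
   Context: Interpretation of the data: $n$ service options are offered to a traveler; option $j$ has service type $y_j$, standard fare $f_j$, operating cost $c_j$, travel time $T_j$, and fare adjustment $\delta_j\in\mathbb{R}$ (the only decision variable). The traveler chooses option $j$ with multinomial logit probability $e^{U_j}/(\sum_{k=1}^n e^{U_k}+e^{U_0})$, where $U_j$ is the utility of option $j$ and $U_0$ is the constant utility of rejecting all options; the operator's profit if option $j$ is chosen is $f_j+\delta_j-c_j$. The objective is the expected profit. For each service type $y$, $U'_y$ is a function of the fare and travel time giving the part of the utility that does not depend on the fare adjustment. In the algorithm the superscript $k$ is the iteration index, $z^k$ is the $k$-th iterate for $z^*$, and $\delta^k=(\delta_1^k,\dots,\delta_n^k)$ are the corresponding fare adjustments; the statement does not specify a starting value. *)

theory Defs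
  imports "HOL-Analysis.Analysis"
begin

datatype service_type = Single | Shared

text \<open>
  The options are indexed by an arbitrary finite type \<open>'n\<close>, so a vector of fare adjustments
  is an element of \<open>real ^ 'n\<close>.  The locale only bundles the data of a problem instance;
  it carries no assumptions.  The parameters \<open>e\<^sub>1\<close> and \<open>e\<^sub>2\<close> give, for each service type,
  the sensitivity to a discount and to a surcharge, respectively.
\<close>

locale fare_model =
  fixes y :: "service_type ^ 'n"
    and f c T :: "real ^ 'n"
    and U' :: "service_type \<Rightarrow> real \<Rightarrow> real \<Rightarrow> real"
    and U\<^sub>0 :: real
    and e\<^sub>1 e\<^sub>2 :: "service_type \<Rightarrow> real"
begin

definition E :: "service_type \<Rightarrow> real \<Rightarrow> real" where
  "E s x = - e\<^sub>1 s * min 0 x - e\<^sub>2 s * max 0 x"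

definition base_utility :: "'n \<Rightarrow> real" where
  "base_utility j = U' (y $ j) (f $ j) (T $ j)"

definition utility :: "'n \<Rightarrow> real \<Rightarrow> real" where
  "utility j x = base_utility j + E (y $ j) x"

definition expected_profit :: "real ^ 'n \<Rightarrow> real" where
  "expected_profit \<delta> =
     (\<Sum>j\<in>UNIV. exp (utility j (\<delta> $ j)) * (f $ j - c $ j + \<delta> $ j)) /
     ((\<Sum>j\<in>UNIV. exp (utility j (\<delta> $ j))) + exp U\<^sub>0)"

definition V :: "'n \<Rightarrow> real" where
  "V j = exp (base_utility j)"

definition V\<^sub>0 :: real where
  "V\<^sub>0 = exp U\<^sub>0"

definition adjustment_step :: "real \<Rightarrow> real ^ 'n" where
  "adjustment_step z = (\<chi> j.
     if z - f $ j + c $ j + 1 / e\<^sub>1 (y $ j) < 0 then z - f $ j + c $ j + 1 / e\<^sub>1 (y $ j)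
     else if z - f $ j + c $ j + 1 / e\<^sub>2 (y $ j) > 0 then z - f $ j + c $ j + 1 / e\<^sub>2 (y $ j)
     else 0)"

definition value_step :: "real ^ 'n \<Rightarrow> real" where
  "value_step \<delta> =
     (\<Sum>j\<in>UNIV. V j * exp (E (y $ j) (\<delta> $ j)) * (f $ j - c $ j + \<delta> $ j)) /
     ((\<Sum>j\<in>UNIV. V j * exp (E (y $ j) (\<delta> $ j))) + V\<^sub>0)"

text \<open>
  \<open>z_iterate z\<^sub>0 k\<close> is the \<open>k\<close>-th value iterate when started at \<open>z\<^sub>0\<close>; the fare adjustments
  computed in step \<open>k + 1\<close> are \<open>adjustment_step (z_iterate z\<^sub>0 k)\<close>.
\<close>

primrec z_iterate :: "real \<Rightarrow> nat \<Rightarrow> real" where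
  "z_iterate z\<^sub>0 0 = z\<^sub>0"
| "z_iterate z\<^sub>0 (Suc k) = value_step (adjustment_step (z_iterate z\<^sub>0 k))"

end

end

theory Submission
  imports Defs
begin

text \<open>
  The algorithm is Dinkelbach's method for the ratio \<open>N(\<delta>) / D(\<delta>)\<close>: the adjustment step at \<open>z\<close>
  maximises \<open>N(\<delta>) - z D(\<delta>)\<close>, which separates over the options.  For one option with
  \<open>p = z - f + c\<close>, the function \<open>E\<close> lies below every line \<open>x \<mapsto> - a x\<close> with \<open>e\<^sub>1 \<le> a \<le> e\<^sub>2\<close>, and
  \<open>exp (- a x) (x - p)\<close> is maximal at \<open>p + 1 / a\<close>; the three cases of the step are exactly those
  for which \<open>a\<close> can be chosen such that \<open>E\<close> touches the line at this maximiser.  Hence from the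
  first step on the iterates increase, they are bounded, and by continuity of the step their limit
  is a fixed point; a fixed point is the maximal ratio, hence unique.
\<close>

text \<open>The inequality \<open>1 + u \<le> exp u\<close> at \<open>u = a * (x - p) - 1\<close>;
  equality at \<open>u = 0\<close> is the maximiser \<open>x = p + 1 / a\<close>.\<close>

lemma exp_mult_linear_le:
  fixes a p x :: real
  assumes "a > 0"
  shows "exp (- a * x) * (x - p) \<le> exp (- a * (p + 1 / a)) * (1 / a)"
proof -
  have "a * (x - p) \<le> exp (a * (x - p) - 1)"
    using exp_ge_add_one_self[of "a * (x - p) - 1"] by simp
  then have "x - p \<le> exp (a * (x - p) - 1) * (1 / a)"
    using assms by (simp add: field_simps)
  then have "exp (- a * x) * (x - p) \<le> exp (- a * x) * (exp (a * (x - p) - 1) * (1 / a))"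
    by (rule mult_left_mono) simp
  also have "\<dots> = exp (- a * x + (a * (x - p) - 1)) * (1 / a)"
    by (simp only: exp_add mult.assoc)
  also have "- a * x + (a * (x - p) - 1) = - a * (p + 1 / a)"
    using assms by (simp add: field_simps)
  finally show ?thesis .
qed

locale loss_averse_fare_model = fare_model y f c T U' U\<^sub>0 e\<^sub>1 e\<^sub>2
  for y :: "service_type ^ 'n"
    and f c T :: "real ^ 'n"
    and U' U\<^sub>0 e\<^sub>1 e\<^sub>2 +
  assumes e_less: "\<And>s. e\<^sub>1 s < e\<^sub>2 s"
    and e_pos: "\<And>s. 0 < e\<^sub>1 s"
begin

lemma E_le_linear:
  assumes "e\<^sub>1 s \<le> a" "a \<le> e\<^sub>2 s"
  shows "E s x \<le> - a * x"
proof (cases "x \<le> 0")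
  case True
  then have "a * x \<le> e\<^sub>1 s * x"
    using assms by (intro mult_right_mono_neg) auto
  then show ?thesis
    using True by (simp add: E_def)
next
  case False
  then have "a * x \<le> e\<^sub>2 s * x"
    using assms by (intro mult_right_mono) auto
  then show ?thesis
    using False by (simp add: E_def)
qed

lemma adjustment_step_tangent:
  obtains a where "e\<^sub>1 (y $ j) \<le> a" "a \<le> e\<^sub>2 (y $ j)"
    and "adjustment_step z $ j = z - f $ j + c $ j + 1 / a"
    and "E (y $ j) (adjustment_step z $ j) = - a * (adjustment_step z $ j)"
proof -
  define p where "p = z - f $ j + c $ j"
  have pos: "0 < e\<^sub>1 (y $ j)" "0 < e\<^sub>2 (y $ j)" "e\<^sub>1 (y $ j) < e\<^sub>2 (y $ j)"
    using e_pos[of "y $ j"] e_less[of "y $ j"] by auto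
  consider "p + 1 / e\<^sub>1 (y $ j) < 0" | "\<not> p + 1 / e\<^sub>1 (y $ j) < 0" "p + 1 / e\<^sub>2 (y $ j) > 0"
    | "\<not> p + 1 / e\<^sub>1 (y $ j) < 0" "\<not> p + 1 / e\<^sub>2 (y $ j) > 0"
    by blast
  then show thesis
  proof cases
    case 1
    then show thesis
      using pos by (intro that[of "e\<^sub>1 (y $ j)"]) (auto simp: adjustment_step_def E_def p_def)
  next
    case 2
    then show thesis
      using pos by (intro that[of "e\<^sub>2 (y $ j)"]) (auto simp: adjustment_step_def E_def p_def)
  next
    case 3
    have "0 < 1 / e\<^sub>2 (y $ j)"
      using pos by simp
    then have "p < 0"
      using 3 by linarith
    show thesis
    \<comment> \<open>This slope makes \<open>p + 1 / a = 0\<close>, the kink of \<open>E\<close>,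
      where every line through the origin touches it. The two failed tests say exactly that it lies
      between the two sensitivities.\<close>
    proof (rule that[of "- 1 / p"])
      show "e\<^sub>1 (y $ j) \<le> - 1 / p" "- 1 / p \<le> e\<^sub>2 (y $ j)"
        using 3 pos \<open>p < 0\<close> by (auto simp: field_simps)
    qed (use 3 \<open>p < 0\<close> in \<open>auto simp: adjustment_step_def E_def p_def\<close>)
  qed
qed

lemma adjustment_step_optimal_component:
  "exp (E (y $ j) x) * (f $ j - c $ j + x - z)
    \<le> exp (E (y $ j) (adjustment_step z $ j)) * (f $ j - c $ j + adjustment_step z $ j - z)"
proof -
  define p where "p = z - f $ j + c $ j"
  obtain a where a: "e\<^sub>1 (y $ j) \<le> a" "a \<le> e\<^sub>2 (y $ j)"
    and step: "adjustment_step z $ j = p + 1 / a"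
    and E_step: "E (y $ j) (adjustment_step z $ j) = - a * (p + 1 / a)"
    using adjustment_step_tangent[of j z] unfolding p_def by metis
  have "a > 0"
    using a e_pos[of "y $ j"] by linarith
  have "exp (E (y $ j) x) * (x - p) \<le> exp (- a * (p + 1 / a)) * (1 / a)"
  \<comment> \<open>Replacing \<open>E\<close> by the line enlarges the product only when the margin
    \<open>x - p\<close> is nonnegative; otherwise the product is nonpositive and the bound is
    trivial.\<close>
  proof (cases "x \<le> p")
    case True
    then have "exp (E (y $ j) x) * (x - p) \<le> 0"
      by (simp add: mult_nonneg_nonpos)
    also have "0 \<le> exp (- a * (p + 1 / a)) * (1 / a)"
      using \<open>a > 0\<close> by simp
    finally show ?thesis .
  next
    case False
    then have "exp (E (y $ j) x) * (x - p) \<le> exp (- a * x) * (x - p)"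
      using E_le_linear[OF a] by (intro mult_right_mono) auto
    also have "\<dots> \<le> exp (- a * (p + 1 / a)) * (1 / a)"
      by (rule exp_mult_linear_le) fact
    finally show ?thesis .
  qed
  then show ?thesis
    unfolding E_step by (simp add: step p_def algebra_simps)
qed

definition profit_numerator :: "real ^ 'n \<Rightarrow> real" where
  "profit_numerator \<delta> = (\<Sum>j\<in>UNIV. V j * exp (E (y $ j) (\<delta> $ j)) * (f $ j - c $ j + \<delta> $ j))"

definition profit_denominator :: "real ^ 'n \<Rightarrow> real" where
  "profit_denominator \<delta> = (\<Sum>j\<in>UNIV. V j * exp (E (y $ j) (\<delta> $ j))) + V\<^sub>0"

lemma value_step_eq_divide: "value_step \<delta> = profit_numerator \<delta> / profit_denominator \<delta>"
  by (simp add: value_step_def profit_numerator_def profit_denominator_def)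

lemma expected_profit_eq_value_step: "expected_profit \<delta> = value_step \<delta>"
  by (simp add: expected_profit_def value_step_def utility_def V_def V\<^sub>0_def exp_add)

lemma V\<^sub>0_pos: "V\<^sub>0 > 0"
  by (simp add: V\<^sub>0_def)

lemma profit_denominator_ge: "V\<^sub>0 \<le> profit_denominator \<delta>"
  by (simp add: profit_denominator_def V_def sum_nonneg)

lemma profit_denominator_pos: "profit_denominator \<delta> > 0"
  using V\<^sub>0_pos profit_denominator_ge[of \<delta>] by linarith

lemma adjustment_step_optimal:
  "profit_numerator \<delta> - z * profit_denominator \<delta>
    \<le> profit_numerator (adjustment_step z) - z * profit_denominator (adjustment_step z)"
proof -
  \<comment> \<open>For fixed \<open>z\<close> the difference splits into one term per option and a
    constant, so it can be maximised componentwise.\<close>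
  have eq: "profit_numerator \<delta> - z * profit_denominator \<delta>
      = (\<Sum>j\<in>UNIV. V j * (exp (E (y $ j) (\<delta> $ j)) * (f $ j - c $ j + \<delta> $ j - z))) - z * V\<^sub>0" for \<delta>
    by (simp add: profit_numerator_def profit_denominator_def sum_distrib_left
        sum_subtractf[symmetric] algebra_simps)
  show ?thesis
    unfolding eq
    by (intro diff_right_mono sum_mono mult_left_mono adjustment_step_optimal_component)
      (simp add: V_def)
qed

text \<open>At a fixed point the maximum of numerator minus \<open>z\<close> times denominator is
  zero, so no ratio exceeds \<open>z\<close>.\<close>

lemma value_step_le_fixed_point:
  assumes "value_step (adjustment_step z) = z"
  shows "value_step \<delta> \<le> z"
proof -
  have "profit_numerator (adjustment_step z) - z * profit_denominator (adjustment_step z) = 0"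
    using assms profit_denominator_pos[of "adjustment_step z"]
    by (simp add: value_step_eq_divide field_simps)
  then have "profit_numerator \<delta> \<le> z * profit_denominator \<delta>"
    using adjustment_step_optimal[of \<delta> z] by simp
  then show ?thesis
    by (simp add: value_step_eq_divide pos_divide_le_eq profit_denominator_pos)
qed

text \<open>Since \<open>z\<close> is an attained ratio, the maximised difference is at least its
  value zero at \<open>\<delta>\<close>.\<close>

lemma value_step_increasing:
  assumes "z = value_step \<delta>"
  shows "z \<le> value_step (adjustment_step z)"
proof -
  have "profit_numerator \<delta> - z * profit_denominator \<delta> = 0"
    using assms profit_denominator_pos[of \<delta>] by (simp add: value_step_eq_divide)
  then have "z * profit_denominator (adjustment_step z) \<le> profit_numerator (adjustment_step z)"
    using adjustment_step_optimal[of \<delta> z] by simp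
  then show ?thesis
    by (simp add: value_step_eq_divide pos_le_divide_eq profit_denominator_pos)
qed

text \<open>The step at \<open>0\<close> maximises the numerator itself. Truncating this maximum at
  \<open>0\<close> allows the denominator to be replaced by its lower bound
  \<open>V\<^sub>0\<close>.\<close>

lemma value_step_bounded: "value_step \<delta> \<le> max 0 (profit_numerator (adjustment_step 0)) / V\<^sub>0"
proof -
  have "value_step \<delta> \<le> max 0 (profit_numerator (adjustment_step 0)) / profit_denominator \<delta>"
    unfolding value_step_eq_divide
    using adjustment_step_optimal[of \<delta> 0] profit_denominator_pos[of \<delta>]
    by (intro divide_right_mono) auto
  also have "\<dots> \<le> max 0 (profit_numerator (adjustment_step 0)) / V\<^sub>0"
    using V\<^sub>0_pos profit_denominator_ge by (intro divide_left_mono) (auto simp: profit_denominator_pos)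
  finally show ?thesis .
qed

text \<open>At most one summand is nonzero because \<open>1 / e\<^sub>2 < 1 / e\<^sub>1\<close>.
  This form makes continuity across the case boundaries evident.\<close>

lemma adjustment_step_eq_min_max:
  "adjustment_step z $ j =
    min 0 (z - f $ j + c $ j + 1 / e\<^sub>1 (y $ j)) + max 0 (z - f $ j + c $ j + 1 / e\<^sub>2 (y $ j))"
proof -
  have "1 / e\<^sub>2 (y $ j) < 1 / e\<^sub>1 (y $ j)"
    using e_pos[of "y $ j"] e_less[of "y $ j"] by (intro divide_strict_left_mono) auto
  then show ?thesis
    by (auto simp: adjustment_step_def)
qed

lemma continuous_value_step_adjustment_step: "isCont (\<lambda>z. value_step (adjustment_step z)) z"
proof -
  have "profit_denominator (adjustment_step z) \<noteq> 0"
    using profit_denominator_pos[of "adjustment_step z"] by simp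
  then show ?thesis
    unfolding value_step_eq_divide profit_numerator_def profit_denominator_def E_def
      adjustment_step_eq_min_max
    by (intro continuous_intros)
qed

lemma z_iterate_convergent:
  obtains L where "z_iterate z\<^sub>0 \<longlonglongrightarrow> L" "value_step (adjustment_step L) = L"
proof -
  \<comment> \<open>The shift drops the arbitrary starting value, which need not be an attained
    ratio and may exceed all later iterates.\<close>
  let ?X = "\<lambda>k. z_iterate z\<^sub>0 (Suc k)"
  have "incseq ?X"
    by (intro incseq_SucI, subst (2) z_iterate.simps, rule value_step_increasing) simp
  moreover have "?X k \<le> max 0 (profit_numerator (adjustment_step 0)) / V\<^sub>0" for k
    using value_step_bounded by simp
  ultimately obtain L where X: "?X \<longlonglongrightarrow> L"
    using incseq_convergent by blast
  then have L: "z_iterate z\<^sub>0 \<longlonglongrightarrow> L"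
    by (rule LIMSEQ_imp_Suc)
  have "?X \<longlonglongrightarrow> value_step (adjustment_step L)"
    using isCont_tendsto_compose[OF continuous_value_step_adjustment_step L] by simp
  then show thesis
    using that L X LIMSEQ_unique by blast
qed

end

theorem proposition2:
  fixes y :: "service_type ^ 'n"
    and f c T :: "real ^ 'n"
    and U' :: "service_type \<Rightarrow> real \<Rightarrow> real \<Rightarrow> real"
    and U\<^sub>0 :: real
    and e\<^sub>1 e\<^sub>2 :: "service_type \<Rightarrow> real"
  assumes "\<And>j. f $ j \<ge> 0" and "\<And>j. c $ j \<ge> 0" and "\<And>j. T $ j \<ge> 0"
    and "\<And>s. e\<^sub>2 s > e\<^sub>1 s" and "\<And>s. e\<^sub>1 s > 0"
  shows "\<exists>\<delta>_opt :: real ^ 'n.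
           (\<forall>\<delta>. fare_model.expected_profit y f c T U' U\<^sub>0 e\<^sub>1 e\<^sub>2 \<delta>
                \<le> fare_model.expected_profit y f c T U' U\<^sub>0 e\<^sub>1 e\<^sub>2 \<delta>_opt) \<and>
           (\<forall>z_init. fare_model.z_iterate y f c T U' U\<^sub>0 e\<^sub>1 e\<^sub>2 z_init
                \<longlonglongrightarrow> fare_model.expected_profit y f c T U' U\<^sub>0 e\<^sub>1 e\<^sub>2 \<delta>_opt)"
proof -
  interpret loss_averse_fare_model y f c T U' U\<^sub>0 e\<^sub>1 e\<^sub>2
    by unfold_locales (use assms in auto)
  obtain L where L: "value_step (adjustment_step L) = L"
    using z_iterate_convergent[of 0] by blast
  have "z_iterate z_init \<longlonglongrightarrow> L" for z_init
  proof -
    obtain L' where "z_iterate z_init \<longlonglongrightarrow> L'" and L': "value_step (adjustment_step L') = L'"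
      using z_iterate_convergent by blast
    \<comment> \<open>Each fixed point is itself an attained ratio, so each is bounded by the
      other.\<close>
    moreover have "L' = L"
      using value_step_le_fixed_point[OF L, of "adjustment_step L'"]
        value_step_le_fixed_point[OF L', of "adjustment_step L"] L L' by simp
    ultimately show ?thesis
      by simp
  qed
  then show ?thesis
    using value_step_le_fixed_point[OF L] L
    by (intro exI[of _ "adjustment_step L"]) (simp add: expected_profit_eq_value_step)
qed

end
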